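(* Let $\varepsilon=\varepsilon(n)$, $\beta=\beta(n)$ take values in $(0,1)$ and satisfy $\varepsilon \le \frac16$, $\beta \le \frac{\varepsilon^{2.5}}{16}$, and $\varepsilon = \Omega\!\left(\frac{(\log n)^{1/5}}{n^{1/5}}\right)$. Then there exists a gossip algorithm using messages of size $O(\log n)$ that, in the presence of a $\beta$-strong adversary, reduces any $\varepsilon$-approximate quantile problem to an $\varepsilon$-approximate median problem with high probability in $O\!\left(\log\frac1\varepsilon\right)$ rounds.
   Context: Gossip model: there are $n$ nodes, every pair of which can communicate (complete graph). Each node initially holds a value that is polynomially bounded in $n$. Communication proceeds in synchronous rounds; in each round every node chooses a node uniformly at random (possibly itself) and either pushes a message to it or pulls a message from it. $\beta$-strong adversary: at the beginning of each round the adversary chooses at most $\beta n$ nodes; any message pulled from or pushed to these nodes in that round can be replaced arbitrarily by the adversary. The adversary does not know in advance the random choice of communication partners in the current round, but otherwise is unrestricted (unbounded computational power, knows the full history). $\varepsilon$-approximate $\phi$-quantile problem (for $\phi\in(0,1)$): output a value whose rank among the $n$ initial values lies in $[(\phi-\varepsilon)n,(\phi+\varepsilon)n]$; the $\varepsilon$-approximate median problem is the case $\phi=1/2$. Reducing the $\varepsilon$-approximate $\phi$-quantile problem to the $\varepsilon$-approximate median problem means that the algorithm transforms the values stored at the nodes so that an $\varepsilon$-approximate median of the new values is an $\varepsilon$-approximate $\phi$-quantile of the original values. "With high probability" means with probability $1-n^{-\Omega(1)}$. *)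

theory Defs
  imports "HOL-Probability.Probability" "HOL-Library.Landau_Symbols"
begin

section \<open>Approximate quantiles\<close>

text \<open>
  An instance is a family of values \<open>x 0, \<dots>, x (n - 1)\<close>; arguments \<open>\<ge> n\<close> are irrelevant.
  Repeated values are ordered arbitrarily, so a value \<open>q\<close> that occurs in the instance has every
  position it can take in a sorted listing as a rank. A value that does not occur (an adversary can
  inject such values into the network) has the number of values not exceeding it as its only rank.
  For an occurring \<open>q\<close> the inserted element already lies in the interval.
\<close>

definition count_less :: "nat \<Rightarrow> (nat \<Rightarrow> int) \<Rightarrow> int \<Rightarrow> nat" where
  "count_less n x q = card {i. i < n \<and> x i < q}"

definition count_le :: "nat \<Rightarrow> (nat \<Rightarrow> int) \<Rightarrow> int \<Rightarrow> nat" where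
  "count_le n x q = card {i. i < n \<and> x i \<le> q}"

definition ranks :: "nat \<Rightarrow> (nat \<Rightarrow> int) \<Rightarrow> int \<Rightarrow> nat set" where
  "ranks n x q = insert (count_le n x q) {count_less n x q <.. count_le n x q}"

definition approx_quantile :: "nat \<Rightarrow> (nat \<Rightarrow> int) \<Rightarrow> real \<Rightarrow> real \<Rightarrow> int \<Rightarrow> bool" where
  "approx_quantile n x \<epsilon> \<phi> q \<longleftrightarrow>
     (\<exists>r \<in> ranks n x q. (\<phi> - \<epsilon>) * real n \<le> real r \<and> real r \<le> (\<phi> + \<epsilon>) * real n)"

definition approx_median :: "nat \<Rightarrow> (nat \<Rightarrow> int) \<Rightarrow> real \<Rightarrow> int \<Rightarrow> bool" where
  "approx_median n x \<epsilon> q \<longleftrightarrow> approx_quantile n x \<epsilon> (1/2) q"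

definition reduces_to_median ::
  "nat \<Rightarrow> real \<Rightarrow> real \<Rightarrow> (nat \<Rightarrow> int) \<Rightarrow> (nat \<Rightarrow> int) \<Rightarrow> bool" where
  "reduces_to_median n \<epsilon> \<phi> x y \<longleftrightarrow>
     (\<forall>q. approx_median n y \<epsilon> q \<longrightarrow> approx_quantile n x \<epsilon> \<phi> q)"

section \<open>Gossip algorithms\<close>

type_synonym message = "bool list"

text \<open>
  All nodes run the same program on local states of type \<open>'s\<close>; the first argument of each of
  \<open>toss\<close>, \<open>push\<close>, \<open>reply\<close>, \<open>update\<close> is the number of the round.
  A round consists of: a local random transition \<open>toss\<close>; the choice of a uniformly random
  partner; the push of \<open>m\<close> to that partner if \<open>push\<close> is \<open>Some m\<close>, and a pull from it
  (answered by the partner's \<open>reply\<close>) if \<open>push\<close> is \<open>None\<close>; and finally \<open>update\<close>, which is given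
  the pulled message, if any, and the multiset of messages that were pushed to the node.
\<close>

record 's gossip_alg =
  init   :: "int \<Rightarrow> 's"
  toss   :: "nat \<Rightarrow> 's \<Rightarrow> 's pmf"
  push   :: "nat \<Rightarrow> 's \<Rightarrow> message option"
  reply  :: "nat \<Rightarrow> 's \<Rightarrow> message"
  update :: "nat \<Rightarrow> 's \<Rightarrow> message option \<Rightarrow> message multiset \<Rightarrow> 's"
  result :: "'s \<Rightarrow> int"

definition message_size_le :: "'s gossip_alg \<Rightarrow> real \<Rightarrow> bool" where
  "message_size_le A b \<longleftrightarrow>
     (\<forall>r s. real (length (reply A r s)) \<le> b \<and>
            (\<forall>m. push A r s = Some m \<longrightarrow> real (length m) \<le> b))"

section \<open>The adversary\<close>

text \<open>
  A plan for a round consists of the set of attacked nodes and of the forged messages. The set is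
  fixed before the partners are drawn, whereas the forged messages may depend on all
  partners drawn in the round. Every node initiates exactly one message transfer per round,
  so \<open>forge t v\<close> is the replacement for the message that \<open>v\<close> pushes to or pulls from its
  partner \<open>t v\<close>.
\<close>

type_synonym plan = "nat set \<times> ((nat \<Rightarrow> nat) \<Rightarrow> nat \<Rightarrow> message)"

record 's round_log =
  tossed   :: "nat \<Rightarrow> 's"
  planned  :: plan
  partners :: "nat \<Rightarrow> nat"
  after    :: "nat \<Rightarrow> 's"

text \<open>
  The adversary sees the log of all previous rounds (latest first) and the states of all nodes after
  the local coin tosses of the current round, and may use randomness of its own.
\<close>

type_synonym 's adversary = "'s round_log list \<Rightarrow> (nat \<Rightarrow> 's) \<Rightarrow> plan pmf"

definition strong_adversary :: "nat \<Rightarrow> real \<Rightarrow> 's adversary \<Rightarrow> bool" where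
  "strong_adversary n \<beta> adv \<longleftrightarrow>
     (\<forall>h s. \<forall>(B, forge) \<in> set_pmf (adv h s). B \<subseteq> {..<n} \<and> real (card B) \<le> \<beta> * real n)"

section \<open>Execution\<close>

text \<open>The message, after interference, on the transfer initiated by \<open>v\<close>.\<close>

definition transferred ::
  "'s gossip_alg \<Rightarrow> nat \<Rightarrow> (nat \<Rightarrow> 's) \<Rightarrow> plan \<Rightarrow> (nat \<Rightarrow> nat) \<Rightarrow> nat \<Rightarrow> message" where
  "transferred A r s p t v =
     (if t v \<in> fst p then snd p t v
      else case push A r (s v) of Some m \<Rightarrow> m | None \<Rightarrow> reply A r (s (t v)))"

definition pulled ::
  "'s gossip_alg \<Rightarrow> nat \<Rightarrow> (nat \<Rightarrow> 's) \<Rightarrow> plan \<Rightarrow> (nat \<Rightarrow> nat) \<Rightarrow> nat \<Rightarrow> message option" where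
  "pulled A r s p t v =
     (if push A r (s v) = None then Some (transferred A r s p t v) else None)"

definition inbox ::
  "'s gossip_alg \<Rightarrow> nat \<Rightarrow> nat \<Rightarrow> (nat \<Rightarrow> 's) \<Rightarrow> plan \<Rightarrow> (nat \<Rightarrow> nat) \<Rightarrow> nat \<Rightarrow> message multiset"
  where
  "inbox A n r s p t v =
     image_mset (transferred A r s p t)
       (mset_set {u. u < n \<and> push A r (s u) \<noteq> None \<and> t u = v})"

definition uniform_partners :: "nat \<Rightarrow> (nat \<Rightarrow> nat) pmf" where
  "uniform_partners n = Pi_pmf {..<n} undefined (\<lambda>_. pmf_of_set {..<n})"

definition current_states ::
  "'s gossip_alg \<Rightarrow> (nat \<Rightarrow> int) \<Rightarrow> 's round_log list \<Rightarrow> nat \<Rightarrow> 's" where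
  "current_states A x h = (case h of [] \<Rightarrow> (\<lambda>v. init A (x v)) | l # _ \<Rightarrow> after l)"

definition gossip_round ::
  "'s gossip_alg \<Rightarrow> nat \<Rightarrow> 's adversary \<Rightarrow> (nat \<Rightarrow> int) \<Rightarrow> nat \<Rightarrow> 's round_log list
     \<Rightarrow> 's round_log pmf" where
  "gossip_round A n adv x r h =
     bind_pmf (Pi_pmf {..<n} undefined (\<lambda>v. toss A r (current_states A x h v))) (\<lambda>s.
     bind_pmf (adv h s) (\<lambda>p.
     bind_pmf (uniform_partners n) (\<lambda>t.
     return_pmf \<lparr> tossed = s, planned = p, partners = t,
       after = (\<lambda>v. update A r (s v) (pulled A r s p t v) (inbox A n r s p t v)) \<rparr>)))"

primrec execution ::
  "'s gossip_alg \<Rightarrow> nat \<Rightarrow> 's adversary \<Rightarrow> (nat \<Rightarrow> int) \<Rightarrow> nat \<Rightarrow> 's round_log list pmf" where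
  "execution A n adv x 0 = return_pmf []"
| "execution A n adv x (Suc r) =
     bind_pmf (execution A n adv x r) (\<lambda>h. map_pmf (\<lambda>l. l # h) (gossip_round A n adv x r h))"

definition final_values ::
  "'s gossip_alg \<Rightarrow> nat \<Rightarrow> 's adversary \<Rightarrow> (nat \<Rightarrow> int) \<Rightarrow> nat \<Rightarrow> (nat \<Rightarrow> int) pmf" where
  "final_values A n adv x T =
     map_pmf (\<lambda>h v. result A (current_states A x h v)) (execution A n adv x T)"

end

theory Submission
  imports Defs "HOL-Real_Asymp.Real_Asymp"
begin

text \<open>
  For nine rounds every node pulls an initial value, and independently with probability \<open>p\<close> replaces
  the sample by a dummy, the smallest possible value if \<open>\<phi> \<le> 1/2\<close> and the largest one otherwise;
  its new value is the median of its nine samples. Choosing \<open>p \<le> 1/2\<close> so that the dummies move the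
  \<open>\<phi>\<close>-quantile to the median, a sample is \<open>\<le> q\<close> with probability at most \<open>1/2 - \<epsilon>/2\<close> if \<open>q\<close> has rank
  below \<open>(\<phi> - \<epsilon>) n\<close>. The majority function of nine trials has slope greater than \<open>2\<close> around \<open>1/2\<close>, so
  the median of the samples is \<open>\<le> q\<close> with probability at most \<open>1/2 - 1.16 \<epsilon>\<close>; likewise from above.
  The slack of \<open>0.16 \<epsilon>\<close> absorbs the Hoeffding deviations and the at most about \<open>9 \<beta> n \<le> (9/96) \<epsilon> n\<close>
  nodes that ever receive a forged message. What the honest samples would be does not depend on
  the adversary, so the nodes whose ideal median is \<open>\<le> q\<close> are exactly binomially distributed in number.
\<close>

section \<open>The majority of nine Bernoulli trials\<close>

definition majority_prob :: "real \<Rightarrow> real" where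
  "majority_prob w = measure_pmf.prob (binomial_pmf 9 w) {j. 5 \<le> j}"

lemma majority_prob_poly:
  assumes "w \<in> {0..1}"
  shows "majority_prob w = 126 * w^5 - 420 * w^6 + 540 * w^7 - 315 * w^8 + 70 * w^9"
proof -
  have "majority_prob w = 1 - measure_pmf.prob (binomial_pmf 9 w) {..4}"
    unfolding majority_prob_def
    by (subst measure_pmf.prob_compl[symmetric]) (auto intro!: arg_cong[where f = "measure_pmf.prob _"])
  also have "\<dots> = 1 - (\<Sum>j\<le>4. real (9 choose j) * w ^ j * (1 - w) ^ (9 - j))"
    using assms by (subst measure_measure_pmf_finite) simp_all
  also have "\<dots> = 126 * w^5 - 420 * w^6 + 540 * w^7 - 315 * w^8 + 70 * w^9"
    by (simp add: atMost_nat_numeral atMost_Suc numeral_eq_Suc) (simp add: algebra_simps)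
  finally show ?thesis .
qed

lemma majority_prob_mono:
  assumes "0 \<le> a" "a \<le> b" "b \<le> 1"
  shows "majority_prob a \<le> majority_prob b"
proof -
  have "126 * a^5 - 420 * a^6 + 540 * a^7 - 315 * a^8 + 70 * a^9
      \<le> 126 * b^5 - 420 * b^6 + 540 * b^7 - 315 * b^8 + 70 * b^9"
  proof (rule DERIV_nonneg_imp_nondecreasing[OF assms(2)])
    fix w :: real
    \<comment> \<open>This derivative is the Beta(5,5) density, the density of the median of nine
      uniform variables; 630 = 9 * (8 choose 4).\<close>
    have "((\<lambda>w. 126 * w^5 - 420 * w^6 + 540 * w^7 - 315 * w^8 + 70 * w^9)
        has_real_derivative 630 * (w * (1 - w)) ^ 4) (at w)"
      by (auto intro!: derivative_eq_intros) (simp add: numeral_eq_Suc, simp add: algebra_simps)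
    moreover have "0 \<le> 630 * (w * (1 - w)) ^ 4"
      by simp
    ultimately show "\<exists>y. ((\<lambda>w. 126 * w^5 - 420 * w^6 + 540 * w^7 - 315 * w^8 + 70 * w^9)
        has_real_derivative y) (at w) \<and> 0 \<le> y"
      by blast
  qed
  then show ?thesis
    using assms by (simp add: majority_prob_poly)
qed

text \<open>Integrating 630 (1/4 - t^2)^4 from 0 to \<eta> gives an odd polynomial with slope
  630/256 > 2.46 at 0. For \<eta> \<le> 1/12 its cubic term costs at most 630/(48 * 144) < 0.1 per
  unit of \<eta>, and the seventh power is dominated by the fifth.\<close>

lemma majority_prob_half_plus:
  assumes "0 \<le> \<eta>" "\<eta> \<le> 1 / 12"
  shows "1 / 2 + 236 / 100 * \<eta> \<le> majority_prob (1 / 2 + \<eta>)"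
proof -
  have poly: "majority_prob (1 / 2 + \<eta>)
      = 1 / 2 + 630 * (\<eta> / 256 - \<eta>^3 / 48 + 3 * \<eta>^5 / 40 - \<eta>^7 / 7 + \<eta>^9 / 9)"
    using assms by (subst majority_prob_poly) (auto simp: numeral_eq_Suc field_simps)
  have sq: "\<eta>^2 \<le> 1 / 144"
    using power_mono[OF assms(2,1), of 2] by (simp add: power_divide)
  have "\<eta>^3 \<le> \<eta> / 144"
    using mult_right_mono[OF sq assms(1)] by (simp add: power3_eq_cube power2_eq_square)
  moreover have "\<eta>^7 \<le> \<eta>^5 / 144"
    using mult_right_mono[OF sq, of "\<eta>^5"] assms(1) by (simp add: power_add[symmetric])
  moreover have "0 \<le> \<eta>^5" "0 \<le> \<eta>^9"
    using assms(1) by simp_all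
  ultimately have "236 / 100 * \<eta>
      \<le> 630 * (\<eta> / 256 - \<eta>^3 / 48 + 3 * \<eta>^5 / 40 - \<eta>^7 / 7 + \<eta>^9 / 9)"
    using assms(1) by argo
  then show ?thesis
    using poly by simp
qed

text \<open>Nine is odd, so exactly one of successes and failures has the majority. This transfers
  bounds above 1/2 to bounds below it.\<close>

lemma majority_prob_compl:
  assumes "w \<in> {0..1}"
  shows "majority_prob (1 - w) = 1 - majority_prob w"
  using assms
  by (subst (1 2) majority_prob_poly) (auto simp: numeral_eq_Suc, simp add: algebra_simps)

lemma majority_prob_ge:
  assumes "0 \<le> \<eta>" "\<eta> \<le> 1 / 12" "1 / 2 + \<eta> \<le> w" "w \<le> 1"
  shows "1 / 2 + 236 / 100 * \<eta> \<le> majority_prob w"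
  using majority_prob_half_plus[OF assms(1,2)] majority_prob_mono[of "1 / 2 + \<eta>" w] assms by simp

lemma majority_prob_le:
  assumes "0 \<le> \<eta>" "\<eta> \<le> 1 / 12" "0 \<le> w" "w \<le> 1 / 2 - \<eta>"
  shows "majority_prob w \<le> 1 / 2 - 236 / 100 * \<eta>"
  using majority_prob_ge[of \<eta> "1 - w"] majority_prob_compl[of w] assms by simp

section \<open>Products of discrete distributions\<close>

text \<open>A bind with Dirac kernels. The explicit \<open>if\<close> resets the value outside
  \<open>A\<close> from \<open>d'\<close> to \<open>d\<close>.\<close>

lemma map_Pi_pmf_pointwise:
  assumes "finite A"
  shows "map_pmf (\<lambda>g v. if v \<in> A then f v (g v) else d) (Pi_pmf A d' p)
       = Pi_pmf A d (\<lambda>v. map_pmf (f v) (p v))"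
  using Pi_pmf_bind[OF assms, of d p "\<lambda>v y. return_pmf (f v y)" d'] assms
  by (simp add: map_pmf_def)

lemma map_pmf_bool: "map_pmf f M = bernoulli_pmf (measure_pmf.prob M {x. f x})"
proof (rule pmf_eqI)
  fix b
  have "pmf (map_pmf f M) b = measure_pmf.prob M (f -` {b})"
    by (simp add: pmf_map)
  moreover have "f -` {False} = UNIV - {x. f x}" "f -` {True} = {x. f x}"
    by auto
  ultimately show "pmf (map_pmf f M) b = pmf (bernoulli_pmf (measure_pmf.prob M {x. f x})) b"
    using measure_pmf.prob_compl[of "{x. f x}" M] by (cases b) simp_all
qed

lemma bernoulli_pmf_bind_if:
  assumes "p \<in> {0..1}" "u \<in> {0..1}"
  shows "bind_pmf (bernoulli_pmf p) (\<lambda>b. if b then return_pmf c else bernoulli_pmf u)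
       = bernoulli_pmf (p * of_bool c + (1 - p) * u)"
proof (rule pmf_eqI)
  \<comment> \<open>The parameter of \<open>bernoulli_pmf\<close> is its success probability only on
    [0,1], so the mixture has to stay there.\<close>
  have le1: "p * of_bool c + (1 - p) * u \<le> 1"
    using convex_bound_le[of "of_bool c" 1 u p "1 - p"] assms by (cases c) auto
  have ge0: "0 \<le> p * of_bool c + (1 - p) * u"
    using assms by (intro add_nonneg_nonneg mult_nonneg_nonneg) auto
  fix b
  show "pmf (bind_pmf (bernoulli_pmf p) (\<lambda>b. if b then return_pmf c else bernoulli_pmf u)) b
      = pmf (bernoulli_pmf (p * of_bool c + (1 - p) * u)) b"
    using assms le1 ge0 by (cases b; cases c) (simp_all add: pmf_bind, simp_all add: algebra_simps)
qed

text \<open>A two-stage union bound: \<open>Y\<close> collects the failures of the first stage. With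
  \<open>Y\<close> empty it passes a uniform bound through a bind.\<close>

lemma measure_bind_pmf_le:
  assumes "\<And>x. x \<in> set_pmf M \<Longrightarrow> x \<notin> Y \<Longrightarrow> measure_pmf.prob (K x) X \<le> c" "0 \<le> c"
  shows "measure_pmf.prob (bind_pmf M K) X \<le> measure_pmf.prob M Y + c"
proof -
  have as_pmf: "measure_pmf.prob N X = pmf (map_pmf (\<lambda>x. x \<in> X) N) True" for N
    by (simp add: pmf_map vimage_def)
  have "measure_pmf.prob (bind_pmf M K) X
      = measure_pmf.expectation M (\<lambda>x. measure_pmf.prob (K x) X)"
    by (simp add: as_pmf map_bind_pmf pmf_bind)
  also have "\<dots> \<le> measure_pmf.expectation M (\<lambda>x. indicator Y x + c)"
  proof (rule integral_mono_AE)
    show "AE x in M. measure_pmf.prob (K x) X \<le> indicator Y x + c"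
      using assms by (auto simp: AE_measure_pmf_iff indicator_def add_increasing2)
  qed (use assms(2) in \<open>auto intro!: measure_pmf.integrable_const_bound[where B = 1]
        measure_pmf.integrable_const_bound[where B = "1 + c"] add_increasing2 simp: indicator_def\<close>)
  also have "\<dots> = measure_pmf.prob M Y + c"
    by (simp add: measure_pmf.integrable_const_bound[where B = 1])
  finally show ?thesis .
qed

text \<open>Hoeffding's inequality, relaxed from \<open>p\<close> to an upper bound
  \<open>a\<close>: raising the threshold only shrinks the event.\<close>

lemma binomial_upper_tail:
  assumes "0 < n" "p \<in> {0..1}" "p \<le> a" "0 \<le> \<delta>"
  shows "measure_pmf.prob (binomial_pmf n p) {j. (a + \<delta>) * real n \<le> real j} \<le> exp (- 2 * real n * \<delta>\<^sup>2)"
proof -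
  interpret binomial_distribution n p
    using assms(2) by unfold_locales
  have le: "(p + \<delta>) * real n \<le> (a + \<delta>) * real n"
    using assms by (intro mult_right_mono) auto
  have "{j. (a + \<delta>) * real n \<le> real j} \<subseteq> {j. p + \<delta> \<le> real j / real n}"
    using le order_trans[OF le] assms(1) by (simp only: pos_le_divide_eq of_nat_0_less_iff) auto
  then have "measure_pmf.prob (binomial_pmf n p) {j. (a + \<delta>) * real n \<le> real j}
      \<le> measure_pmf.prob (binomial_pmf n p) {j. p + \<delta> \<le> real j / real n}"
    by (rule measure_pmf.finite_measure_mono) simp
  then show ?thesis
    using prob_ge'[OF assms(1,4)] by simp
qed

lemma binomial_lower_tail:
  assumes "0 < n" "p \<in> {0..1}" "a \<le> p" "0 \<le> \<delta>"
  shows "measure_pmf.prob (binomial_pmf n p) {j. real j \<le> (a - \<delta>) * real n} \<le> exp (- 2 * real n * \<delta>\<^sup>2)"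
proof -
  interpret binomial_distribution n p
    using assms(2) by unfold_locales
  have le: "(a - \<delta>) * real n \<le> (p - \<delta>) * real n"
    using assms by (intro mult_right_mono) auto
  have "{j. real j \<le> (a - \<delta>) * real n} \<subseteq> {j. real j / real n \<le> p - \<delta>}"
    using le order_trans[OF _ le] assms(1) by (simp only: pos_divide_le_eq of_nat_0_less_iff) auto
  then have "measure_pmf.prob (binomial_pmf n p) {j. real j \<le> (a - \<delta>) * real n}
      \<le> measure_pmf.prob (binomial_pmf n p) {j. real j / real n \<le> p - \<delta>}"
    by (rule measure_pmf.finite_measure_mono) simp
  then show ?thesis
    using prob_le'[OF assms(1,4)] by simp
qed

section \<open>Forged transfers\<close>

text \<open>Indexed by the initiating node. The algorithm below only pulls, so these are the nodes
  whose received message the adversary can replace.\<close>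

definition forged :: "nat \<Rightarrow> 's round_log \<Rightarrow> nat set" where
  "forged n l = {v \<in> {..<n}. partners l v \<in> fst (planned l)}"

text \<open>For a fixed \<open>B\<close> the partners hit it independently with probability
  \<open>card B / n\<close>, so the count is binomial.\<close>

lemma prob_forged_given_plan:
  assumes "0 < n" "B \<subseteq> {..<n}" "real (card B) \<le> \<beta> * real n" "0 \<le> \<delta>"
  shows "measure_pmf.prob (uniform_partners n)
      {t. (\<beta> + \<delta>) * real n \<le> real (card {v \<in> {..<n}. t v \<in> B})} \<le> exp (- 2 * real n * \<delta>\<^sup>2)"
proof -
  let ?b = "real (card B) / real n"
  have "card B \<le> n"
    using card_mono[OF _ assms(2)] by simp
  then have b: "?b \<in> {0..1}" "?b \<le> \<beta>"
    using assms by (auto simp: field_simps)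
  have "measure_pmf.prob (pmf_of_set {..<n}) {u. u \<in> B} = ?b"
    using assms by (simp add: measure_pmf_of_set Int_absorb1 lessThan_empty_iff)
  then have bern: "map_pmf (\<lambda>u. u \<in> B) (pmf_of_set {..<n}) = bernoulli_pmf ?b"
    by (simp add: map_pmf_bool)
  have "map_pmf (\<lambda>t. card {v \<in> {..<n}. t v \<in> B}) (uniform_partners n)
      = map_pmf (\<lambda>f. card {v \<in> {..<n}. f v})
          (map_pmf (\<lambda>t v. if v \<in> {..<n} then t v \<in> B else False) (uniform_partners n))"
    by (auto simp: map_pmf_comp intro!: map_pmf_cong arg_cong[where f = card])
  also have "\<dots> = map_pmf (\<lambda>f. card {v \<in> {..<n}. f v}) (Pi_pmf {..<n} False (\<lambda>_. bernoulli_pmf ?b))"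
    unfolding uniform_partners_def by (subst map_Pi_pmf_pointwise) (simp_all add: bern)
  also have "\<dots> = binomial_pmf n ?b"
    by (rule binomial_pmf_altdef'[symmetric]) (use b in auto)
  finally have binom: "map_pmf (\<lambda>t. card {v \<in> {..<n}. t v \<in> B}) (uniform_partners n)
      = binomial_pmf n ?b" .
  have "measure_pmf.prob (uniform_partners n)
      {t. (\<beta> + \<delta>) * real n \<le> real (card {v \<in> {..<n}. t v \<in> B})}
      = measure_pmf.prob (binomial_pmf n ?b) {j. (\<beta> + \<delta>) * real n \<le> real j}"
    unfolding binom[symmetric] by (simp add: vimage_def)
  also have "\<dots> \<le> exp (- 2 * real n * \<delta>\<^sup>2)"
    using assms b by (intro binomial_upper_tail) auto
  finally show ?thesis .
qed

text \<open>The plan is drawn before the partners, so conditioning on tosses and plan leaves a fixed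
  attacked set.\<close>

lemma prob_forged_round:
  assumes "0 < n" "strong_adversary n \<beta> adv" "0 \<le> \<delta>"
  shows "measure_pmf.prob (gossip_round A n adv x r h)
      {l. (\<beta> + \<delta>) * real n \<le> real (card (forged n l))} \<le> exp (- 2 * real n * \<delta>\<^sup>2)"
proof -
  let ?c = "exp (- 2 * real n * \<delta>\<^sup>2)"
  have bind_le: "measure_pmf.prob (bind_pmf M K) X \<le> ?c"
    if "\<And>y. y \<in> set_pmf M \<Longrightarrow> measure_pmf.prob (K y) X \<le> ?c" for M :: "'z pmf" and K X
    using measure_bind_pmf_le[of M "{}" K X ?c] that by simp
  show ?thesis
    unfolding gossip_round_def
  proof (rule bind_le, rule bind_le)
    fix s p
    assume "p \<in> set_pmf (adv h s)"
    then have "fst p \<subseteq> {..<n} \<and> real (card (fst p)) \<le> \<beta> * real n"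
      using assms(2) unfolding strong_adversary_def by (cases p) fastforce
    then have p: "fst p \<subseteq> {..<n}" "real (card (fst p)) \<le> \<beta> * real n"
      by simp_all
    from prob_forged_given_plan[OF assms(1) p assms(3)]
    show "measure_pmf.prob
        (bind_pmf (uniform_partners n) (\<lambda>t. return_pmf \<lparr>tossed = s, planned = p, partners = t,
           after = \<lambda>v. update A r (s v) (pulled A r s p t v) (inbox A n r s p t v)\<rparr>))
        {l. (\<beta> + \<delta>) * real n \<le> real (card (forged n l))} \<le> ?c"
      by (simp add: map_pmf_def[symmetric] forged_def vimage_def)
  qed
qed

text \<open>The one-round bound holds for every history, hence against adaptive adversaries; a union
  bound combines the rounds.\<close>

lemma prob_forged_execution:
  fixes A :: "'s gossip_alg"
  assumes "0 < n" "strong_adversary n \<beta> adv" "0 \<le> \<delta>"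
  shows "measure_pmf.prob (execution A n adv x r)
      {h. \<exists>l \<in> set h. (\<beta> + \<delta>) * real n \<le> real (card (forged n l))}
      \<le> real r * exp (- 2 * real n * \<delta>\<^sup>2)"
proof (induction r)
  case (Suc r)
  let ?bad = "\<lambda>l. (\<beta> + \<delta>) * real n \<le> real (card (forged n l))"
  have "measure_pmf.prob (execution A n adv x (Suc r)) {h. \<exists>l \<in> set h. ?bad l}
      \<le> measure_pmf.prob (execution A n adv x r) {h. \<exists>l \<in> set h. ?bad l} + exp (- 2 * real n * \<delta>\<^sup>2)"
    unfolding execution.simps
  proof (rule measure_bind_pmf_le)
    fix h :: "'s round_log list"
    assume "h \<notin> {h. \<exists>l \<in> set h. ?bad l}"
    then have "(\<lambda>l. l # h) -` {h. \<exists>l \<in> set h. ?bad l} = {l. ?bad l}"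
      by auto
    then show "measure_pmf.prob (map_pmf (\<lambda>l. l # h) (gossip_round A n adv x r h))
        {h. \<exists>l \<in> set h. ?bad l} \<le> exp (- 2 * real n * \<delta>\<^sup>2)"
      using prob_forged_round[OF assms] by simp
  qed simp
  with Suc.IH show ?case
    by (simp add: algebra_simps)
qed simp

section \<open>The median of a list\<close>

text \<open>For odd length this is the middle entry of the sorted list. With nine entries the
  inequality asks for at least five, as in \<open>majority_prob\<close>.\<close>

definition median :: "int list \<Rightarrow> int" where
  "median zs = Min {z \<in> set zs. length zs < 2 * length (filter (\<lambda>y. y \<le> z) zs)}"

lemma median_props:
  assumes "zs \<noteq> []"
  shows "median zs \<in> set zs"
    and "median zs \<le> q \<longleftrightarrow> length zs < 2 * length (filter (\<lambda>y. y \<le> q) zs)"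
proof -
  let ?S = "{z \<in> set zs. length zs < 2 * length (filter (\<lambda>y. y \<le> z) zs)}"
  have mono: "length (filter (\<lambda>y. y \<le> a) zs) \<le> length (filter (\<lambda>y. y \<le> b) zs)" if "a \<le> b" for a b
    using that by (induction zs) auto
  have "filter (\<lambda>y. y \<le> Max (set zs)) zs = zs"
    by (rule filter_True) auto
  then have "Max (set zs) \<in> ?S"
    using assms by auto
  then have med: "median zs \<in> ?S"
    unfolding median_def by (intro Min_in) auto
  then show "median zs \<in> set zs"
    by simp
  show "median zs \<le> q \<longleftrightarrow> length zs < 2 * length (filter (\<lambda>y. y \<le> q) zs)"
  proof
    assume "median zs \<le> q"
    from mono[OF this] med show "length zs < 2 * length (filter (\<lambda>y. y \<le> q) zs)"
      by simp
  next
    assume q: "length zs < 2 * length (filter (\<lambda>y. y \<le> q) zs)"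
    \<comment> \<open>The largest entry \<le> \<open>q\<close> has the same count as
      \<open>q\<close>, so it qualifies for the minimum even if \<open>q\<close> is not an
      entry.\<close>
    let ?L = "{z \<in> set zs. z \<le> q}"
    have "filter (\<lambda>y. y \<le> q) zs \<noteq> []"
      using q by auto
    then have "?L \<noteq> {}"
      by (auto simp: filter_empty_conv)
    then have max: "Max ?L \<in> ?L"
      by (intro Max_in) auto
    have "filter (\<lambda>y. y \<le> Max ?L) zs = filter (\<lambda>y. y \<le> q) zs"
      using max by (intro filter_cong) (auto intro: Max_ge)
    then have "Max ?L \<in> ?S"
      using max q by auto
    then have "median zs \<le> Max ?L"
      unfolding median_def by (intro Min_le) auto
    then show "median zs \<le> q"
      using max by simp
  qed
qed

section \<open>The sampling algorithm\<close>

text \<open>A state holds the node's own value, the coin of the current round and the samples so far. Only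
  messages have to be short, so a unary encoding of states is good enough.\<close>

definition pack :: "int \<times> bool \<times> int list \<Rightarrow> bool list" where
  "pack s = replicate (to_nat s) True"

definition unpack :: "bool list \<Rightarrow> int \<times> bool \<times> int list" where
  "unpack l = from_nat (length l)"

lemma unpack_pack [simp]: "unpack (pack s) = s"
  by (simp add: pack_def unpack_def)

definition own :: "bool list \<Rightarrow> int" where
  "own s = fst (unpack s)"

definition coin :: "bool list \<Rightarrow> bool" where
  "coin s = fst (snd (unpack s))"

definition samples :: "bool list \<Rightarrow> int list" where
  "samples s = snd (snd (unpack s))"

lemma pack_sel [simp]:
  "own (pack (a, b, c)) = a" "coin (pack (a, b, c)) = b" "samples (pack (a, b, c)) = c"
  by (simp_all add: own_def coin_def samples_def)

text \<open>A forged message need not be a codeword and may decode to an unspecified integer.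
  Clamping keeps the result bounded and leaves honest medians unchanged.\<close>

definition sampling_alg ::
  "int \<Rightarrow> (int \<Rightarrow> message) \<Rightarrow> real \<Rightarrow> int \<Rightarrow> bool list gossip_alg" where
  "sampling_alg M e p d = \<lparr>
     init = (\<lambda>z. pack (z, False, [])),
     toss = (\<lambda>r s. map_pmf (\<lambda>b. pack (own s, b, samples s)) (bernoulli_pmf p)),
     push = (\<lambda>r s. None),
     reply = (\<lambda>r s. e (own s)),
     update = (\<lambda>r s m ms. pack (own s, coin s,
       (if coin s then d else inv_into {-M..M} e (the m)) # samples s)),
     result = (\<lambda>s. max (- M) (min M (median (samples s))))\<rparr>"

lemma sampling_alg_sel [simp]:
  "init (sampling_alg M e p d) z = pack (z, False, [])"
  "toss (sampling_alg M e p d) r s = map_pmf (\<lambda>b. pack (own s, b, samples s)) (bernoulli_pmf p)"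
  "push (sampling_alg M e p d) r s = None"
  "reply (sampling_alg M e p d) r s = e (own s)"
  "update (sampling_alg M e p d) r s m ms = pack (own s, coin s,
     (if coin s then d else inv_into {-M..M} e (the m)) # samples s)"
  "result (sampling_alg M e p d) s = max (- M) (min M (median (samples s)))"
  by (simp_all add: sampling_alg_def)

section \<open>The ideal samples and their exact distribution\<close>

locale sampling =
  fixes n :: nat and M :: int and e :: "int \<Rightarrow> message" and p :: real and d :: int
    and x :: "nat \<Rightarrow> int" and adv :: "bool list adversary"
  assumes n_pos: "0 < n"
    and p_range: "p \<in> {0..1}"
    and e_inj: "inj_on e {-M..M}"
    and d_range: "d \<in> {-M..M}"
    and x_range: "\<And>i. i < n \<Longrightarrow> x i \<in> {-M..M}"
begin

abbreviation "alg \<equiv> sampling_alg M e p d"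

definition ideal_sample :: "bool list round_log \<Rightarrow> nat \<Rightarrow> int" where
  "ideal_sample l v = (if coin (tossed l v) then d else x (partners l v))"

definition hits :: "int \<Rightarrow> bool list round_log list \<Rightarrow> nat \<Rightarrow> nat" where
  "hits q h v = length (filter (\<lambda>l. ideal_sample l v \<le> q) h)"

definition hit_prob :: "int \<Rightarrow> real" where
  "hit_prob q = p * of_bool (d \<le> q) + (1 - p) * (real (count_le n x q) / real n)"

lemma hit_prob_range: "hit_prob q \<in> {0..1}"
proof -
  have "count_le n x q \<le> card {..<n}"
    unfolding count_le_def by (intro card_mono) auto
  then have "real (count_le n x q) / real n \<in> {0..1}"
    using n_pos by simp
  then show ?thesis
    using p_range convex_bound_le[of "of_bool (d \<le> q)" 1 "real (count_le n x q) / real n" p "1 - p"]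
    by (auto simp: hit_prob_def)
qed

text \<open>Given the tosses, the comparisons form a product over the nodes, and mixing over
  independent coins preserves this. The law is the same for every history \<open>h\<close>, which
  makes the rounds independent.\<close>

lemma round_hits_dist:
  "map_pmf (\<lambda>l v. if v < n then ideal_sample l v \<le> q else False) (gossip_round alg n adv x r h)
   = Pi_pmf {..<n} False (\<lambda>_. bernoulli_pmf (hit_prob q))"
proof -
  let ?u = "real (count_le n x q) / real n"
  let ?H = "\<lambda>s. Pi_pmf {..<n} False (\<lambda>v. if coin (s v) then return_pmf (d \<le> q) else bernoulli_pmf ?u)"
  have u: "?u \<in> {0..1}"
  proof -
    have "count_le n x q \<le> card {..<n}"
      unfolding count_le_def by (intro card_mono) auto
    then show ?thesis
      using n_pos by simp
  qed
  have "{..<n} \<inter> {i. x i \<le> q} = {i. i < n \<and> x i \<le> q}"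
    by auto
  then have "measure_pmf.prob (pmf_of_set {..<n}) {i. x i \<le> q} = ?u"
    using n_pos by (simp add: measure_pmf_of_set lessThan_empty_iff count_le_def)
  then have bern: "map_pmf (\<lambda>i. x i \<le> q) (pmf_of_set {..<n}) = bernoulli_pmf ?u"
    by (simp add: map_pmf_bool)
  have H: "map_pmf (\<lambda>t v. if v \<in> {..<n} then (if coin (s v) then d else x (t v)) \<le> q else False)
      (uniform_partners n) = ?H s" for s
    unfolding uniform_partners_def
    by (subst map_Pi_pmf_pointwise)
      (auto intro!: Pi_pmf_cong simp: bern)
  \<comment> \<open>Ideal samples do not mention the plan, so the draw from \<open>adv h s\<close>
    drops out.\<close>
  have "map_pmf (\<lambda>l v. if v < n then ideal_sample l v \<le> q else False) (gossip_round alg n adv x r h)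
      = bind_pmf (Pi_pmf {..<n} undefined (\<lambda>v. toss alg r (current_states alg x h v))) ?H"
    unfolding H[symmetric] gossip_round_def
    by (simp add: map_bind_pmf ideal_sample_def map_pmf_def[symmetric] map_pmf_comp)
  also have "\<dots> = Pi_pmf {..<n} False (\<lambda>v. bind_pmf (toss alg r (current_states alg x h v))
      (\<lambda>s. if coin s then return_pmf (d \<le> q) else bernoulli_pmf ?u))"
    by (rule Pi_pmf_bind[symmetric]) simp
  also have "\<dots> = Pi_pmf {..<n} False (\<lambda>_. bernoulli_pmf (hit_prob q))"
    using bernoulli_pmf_bind_if[OF p_range u]
    by (simp add: bind_map_pmf hit_prob_def)
  finally show ?thesis .
qed

text \<open>By \<open>round_hits_dist\<close>, each round adds a fresh independent trial at every
  node, whatever happened before.\<close>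

lemma hits_dist:
  "map_pmf (\<lambda>h v. if v < n then hits q h v else 0) (execution alg n adv x r)
   = Pi_pmf {..<n} 0 (\<lambda>_. binomial_pmf r (hit_prob q))"
proof (induction r)
  case 0
  show ?case
    using hit_prob_range[of q] by (auto simp: binomial_pmf_0 hits_def)
next
  case (Suc r)
  let ?w = "hit_prob q"
  let ?H = "\<lambda>h v. if v < n then hits q h v else 0"
  let ?add = "\<lambda>g. \<lambda>b v. if v \<in> {..<n} then of_bool (b v) + g v else (0 :: nat)"
  have "map_pmf ?H (execution alg n adv x (Suc r))
      = bind_pmf (execution alg n adv x r) (\<lambda>h. map_pmf (?add (?H h))
          (map_pmf (\<lambda>l v. if v < n then ideal_sample l v \<le> q else False) (gossip_round alg n adv x r h)))"
    by (auto simp: map_bind_pmf map_pmf_comp hits_def intro!: bind_pmf_cong map_pmf_cong)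
  also have "\<dots> = bind_pmf (map_pmf ?H (execution alg n adv x r))
      (\<lambda>g. map_pmf (?add g) (Pi_pmf {..<n} False (\<lambda>_. bernoulli_pmf ?w)))"
    by (simp only: round_hits_dist bind_map_pmf)
  also have "\<dots> = bind_pmf (Pi_pmf {..<n} 0 (\<lambda>_. binomial_pmf r ?w))
      (\<lambda>g. Pi_pmf {..<n} 0 (\<lambda>v. map_pmf (\<lambda>b. of_bool b + g v) (bernoulli_pmf ?w)))"
    unfolding Suc.IH by (subst map_Pi_pmf_pointwise) simp_all
  also have "\<dots> = Pi_pmf {..<n} 0 (\<lambda>_. bind_pmf (binomial_pmf r ?w)
      (\<lambda>k. map_pmf (\<lambda>b. of_bool b + k) (bernoulli_pmf ?w)))"
    by (rule Pi_pmf_bind[symmetric]) simp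
  \<comment> \<open>The recursion of \<open>binomial_pmf\<close> draws the new trial first, the
    execution draws it last; the binds commute.\<close>
  also have "bind_pmf (binomial_pmf r ?w) (\<lambda>k. map_pmf (\<lambda>b. of_bool b + k) (bernoulli_pmf ?w))
      = binomial_pmf (Suc r) ?w"
    using hit_prob_range[of q]
    by (subst binomial_pmf_Suc) (auto simp: map_pmf_def of_bool_def bind_commute_pmf[of "bernoulli_pmf _"])
  finally show ?case .
qed

definition winners :: "int \<Rightarrow> bool list round_log list \<Rightarrow> nat set" where
  "winners q h = {v \<in> {..<n}. 5 \<le> hits q h v}"

text \<open>The nodes win independently, each when at least five of its nine trials succeed.\<close>

lemma card_winners_dist:
  "map_pmf (\<lambda>h. card (winners q h)) (execution alg n adv x 9)
   = binomial_pmf n (majority_prob (hit_prob q))"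
proof -
  have "map_pmf (\<lambda>h. card (winners q h)) (execution alg n adv x 9)
      = map_pmf (\<lambda>b. card {v \<in> {..<n}. b v}) (map_pmf (\<lambda>g v. if v \<in> {..<n} then 5 \<le> g v else False)
          (map_pmf (\<lambda>h v. if v < n then hits q h v else 0) (execution alg n adv x 9)))"
    by (auto simp: map_pmf_comp winners_def intro!: map_pmf_cong arg_cong[where f = card])
  also have "\<dots> = map_pmf (\<lambda>b. card {v \<in> {..<n}. b v})
      (Pi_pmf {..<n} False (\<lambda>_. bernoulli_pmf (majority_prob (hit_prob q))))"
    unfolding hits_dist
    by (subst map_Pi_pmf_pointwise) (simp_all add: map_pmf_bool majority_prob_def)
  also have "\<dots> = binomial_pmf n (majority_prob (hit_prob q))"
    by (rule binomial_pmf_altdef'[symmetric]) (auto simp: majority_prob_def)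
  finally show ?thesis .
qed

lemma prob_winners_ge:
  assumes "majority_prob (hit_prob q) \<le> a" "0 \<le> \<delta>"
  shows "measure_pmf.prob (execution alg n adv x 9) {h. (a + \<delta>) * real n \<le> real (card (winners q h))}
    \<le> exp (- 2 * real n * \<delta>\<^sup>2)"
proof -
  let ?m = "majority_prob (hit_prob q)"
  have "measure_pmf.prob (execution alg n adv x 9) {h. (a + \<delta>) * real n \<le> real (card (winners q h))}
      = measure_pmf.prob (binomial_pmf n ?m) {j. (a + \<delta>) * real n \<le> real j}"
    unfolding card_winners_dist[symmetric] by (simp add: vimage_def)
  also have "\<dots> \<le> exp (- 2 * real n * \<delta>\<^sup>2)"
    using n_pos assms by (intro binomial_upper_tail) (auto simp: majority_prob_def)
  finally show ?thesis .
qed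

lemma prob_winners_le:
  assumes "a \<le> majority_prob (hit_prob q)" "0 \<le> \<delta>"
  shows "measure_pmf.prob (execution alg n adv x 9) {h. real (card (winners q h)) \<le> (a - \<delta>) * real n}
    \<le> exp (- 2 * real n * \<delta>\<^sup>2)"
proof -
  let ?m = "majority_prob (hit_prob q)"
  have "measure_pmf.prob (execution alg n adv x 9) {h. real (card (winners q h)) \<le> (a - \<delta>) * real n}
      = measure_pmf.prob (binomial_pmf n ?m) {j. real j \<le> (a - \<delta>) * real n}"
    unfolding card_winners_dist[symmetric] by (simp add: vimage_def)
  also have "\<dots> \<le> exp (- 2 * real n * \<delta>\<^sup>2)"
    using n_pos assms by (intro binomial_lower_tail) (auto simp: majority_prob_def)
  finally show ?thesis .
qed

text \<open>Replies depend only on own values, which no adversary can alter; hence errors do not propagate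
  from one node to another.\<close>

lemma execution_states:
  assumes "h \<in> set_pmf (execution alg n adv x r)" "v < n"
  shows "length h = r"
    and "own (current_states alg x h v) = x v"
    and "(\<forall>l \<in> set h. v \<notin> forged n l) \<Longrightarrow>
      samples (current_states alg x h v) = map (\<lambda>l. ideal_sample l v) h"
    and "l \<in> set h \<Longrightarrow> partners l v < n"
  using assms
\<comment> \<open>\<open>v\<close> is generalised because the third claim applies the second one to
  the partner \<open>t v\<close>.\<close>
proof (induction r arbitrary: h v l)
  case 0
  {
    case 1 then show ?case by simp
  next
    case 2 then show ?case by (simp add: current_states_def)
  next
    case 3 then show ?case by (simp add: current_states_def)
  next
    case 4 then show ?case by simp
  }
next
  case (Suc r)
  have step: "\<exists>l' h' s pl t. h = l' # h' \<and> h' \<in> set_pmf (execution alg n adv x r) \<and> t \<in> {..<n} \<rightarrow> {..<n} \<and>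
      (\<forall>v < n. own (s v) = own (current_states alg x h' v) \<and>
               samples (s v) = samples (current_states alg x h' v)) \<and>
      l' = \<lparr>tossed = s, planned = pl, partners = t,
        after = \<lambda>v. update alg r (s v) (pulled alg r s pl t v) (inbox alg n r s pl t v)\<rparr>"
    if h_in: "h \<in> set_pmf (execution alg n adv x (Suc r))" for h
  proof -
    obtain h' s pl t where h': "h' \<in> set_pmf (execution alg n adv x r)"
      and s: "s \<in> set_pmf (Pi_pmf {..<n} undefined (\<lambda>v. toss alg r (current_states alg x h' v)))"
      and t: "t \<in> set_pmf (uniform_partners n)"
      and h: "h = \<lparr>tossed = s, planned = pl, partners = t,
        after = \<lambda>v. update alg r (s v) (pulled alg r s pl t v) (inbox alg n r s pl t v)\<rparr> # h'"
      using h_in unfolding execution.simps gossip_round_def by (auto simp del: sampling_alg_sel)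
    have "t \<in> {..<n} \<rightarrow> {..<n}"
      using t n_pos by (auto simp: uniform_partners_def set_Pi_pmf PiE_dflt_def lessThan_empty_iff)
    moreover have "\<forall>v < n. own (s v) = own (current_states alg x h' v) \<and>
        samples (s v) = samples (current_states alg x h' v)"
    proof (intro allI impI)
      fix v
      assume "v < n"
      then have "s v \<in> set_pmf (toss alg r (current_states alg x h' v))"
        using s by (simp add: set_Pi_pmf PiE_dflt_def del: sampling_alg_sel)
      then show "own (s v) = own (current_states alg x h' v) \<and>
          samples (s v) = samples (current_states alg x h' v)"
        by auto
    qed
    ultimately show ?thesis
      using h' h by blast
  qed
  {
    case 1
    with step[OF 1(1)] Suc.IH(1) show ?case by auto
  next
    case 2
    with step[OF 2(1)] Suc.IH(2) show ?case by (auto simp: current_states_def)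
  next
    case 3
    then obtain l' h' s pl t where h: "h = l' # h'" and h': "h' \<in> set_pmf (execution alg n adv x r)"
      and t: "t \<in> {..<n} \<rightarrow> {..<n}"
      and s: "\<And>v. v < n \<Longrightarrow> own (s v) = own (current_states alg x h' v)"
             "\<And>v. v < n \<Longrightarrow> samples (s v) = samples (current_states alg x h' v)"
      and l': "l' = \<lparr>tossed = s, planned = pl, partners = t,
        after = \<lambda>v. update alg r (s v) (pulled alg r s pl t v) (inbox alg n r s pl t v)\<rparr>"
      using step[OF 3(2)] by blast
    have tv: "t v < n" "t v \<notin> fst pl"
      using t 3 by (auto simp: h l' forged_def)
    \<comment> \<open>The partner's own value is still its initial one, even if that partner
      received forged messages earlier.\<close>
    then have "own (s (t v)) = x (t v)"
      using s(1) Suc.IH(2)[OF h'] by simp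
    moreover have "inv_into {-M..M} e (e (x (t v))) = x (t v)"
      using e_inj x_range[OF tv(1)] by (rule inv_into_f_f)
    moreover have "samples (s v) = map (\<lambda>l. ideal_sample l v) h'"
      using s(2) Suc.IH(3)[OF _ h'] 3 by (simp add: h)
    ultimately show ?case
      using tv by (simp add: h l' current_states_def pulled_def transferred_def ideal_sample_def)
  next
    case 4
    with step[OF 4(2)] Suc.IH(4) show ?case by (auto simp: Pi_iff)
  }
qed

text \<open>All ideal samples lie in \<open>{-M..M}\<close>, so clamping changes nothing, and the
  median is compared with \<open>q\<close> by counting hits.\<close>

lemma unforged_result:
  assumes "h \<in> set_pmf (execution alg n adv x 9)" "v < n" "\<forall>l \<in> set h. v \<notin> forged n l"
  shows "result alg (current_states alg x h v) \<le> q \<longleftrightarrow> v \<in> winners q h"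
proof -
  let ?zs = "map (\<lambda>l. ideal_sample l v) h"
  have len: "length h = 9"
    using execution_states(1)[OF assms(1,2)] .
  then have "?zs \<noteq> []"
    by auto
  note median = median_props[OF this]
  have "set ?zs \<subseteq> {-M..M}"
    using execution_states(4)[OF assms(1,2)] d_range x_range by (auto simp: ideal_sample_def)
  with median(1) have "median ?zs \<in> {-M..M}"
    by blast
  then have "result alg (current_states alg x h v) = median ?zs"
    using execution_states(3)[OF assms] by simp
  then show ?thesis
    using median(2)[of q] assms(2) len by (auto simp: winners_def hits_def filter_map o_def)
qed

end

section \<open>Approximate quantiles and ranks\<close>

lemma count_le_mono: "q \<le> q' \<Longrightarrow> count_le n x q \<le> count_le n x q'"
  unfolding count_le_def by (intro card_mono) auto

lemma count_less_eq: "count_less n x q = count_le n x (q - 1)"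
  by (simp add: count_less_def count_le_def zle_diff1_eq)

text \<open>Every rank lies between the two counts, including that of a value that does not
  occur.\<close>

lemma approx_quantile_bounds:
  assumes "approx_quantile n x \<epsilon> \<phi> q"
  shows "(\<phi> - \<epsilon>) * real n \<le> real (count_le n x q)"
    and "real (count_less n x q) \<le> (\<phi> + \<epsilon>) * real n"
proof -
  obtain r where r: "r \<in> ranks n x q" "(\<phi> - \<epsilon>) * real n \<le> real r" "real r \<le> (\<phi> + \<epsilon>) * real n"
    using assms unfolding approx_quantile_def by blast
  have "count_less n x q \<le> count_le n x q"
    by (simp add: count_less_eq count_le_mono)
  then have "count_less n x q \<le> r" "r \<le> count_le n x q"
    using r(1) by (auto simp: ranks_def)
  then show "(\<phi> - \<epsilon>) * real n \<le> real (count_le n x q)" "real (count_less n x q) \<le> (\<phi> + \<epsilon>) * real n"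
    using r(2,3) by linarith+
qed

text \<open>A partial converse: the ranks of an occurring value start at
  \<open>count_less + 1\<close>, and a window of length at least 1 contains an integer.\<close>

lemma approx_quantileI:
  assumes "1 \<le> 2 * \<epsilon> * real n"
    and "(\<phi> - \<epsilon>) * real n \<le> real (count_le n x q)"
    and "real (count_less n x q) + 1 \<le> (\<phi> + \<epsilon>) * real n"
  shows "approx_quantile n x \<epsilon> \<phi> q"
proof (cases "real (count_le n x q) \<le> (\<phi> + \<epsilon>) * real n")
  case True
  then show ?thesis
    using assms(2) by (auto simp: approx_quantile_def ranks_def)
next
  case False
  \<comment> \<open>The largest integer in the window; failure of the first case puts it below
    \<open>count_le\<close>.\<close>
  define r where "r = nat \<lfloor>(\<phi> + \<epsilon>) * real n\<rfloor>"
  have r: "real r \<le> (\<phi> + \<epsilon>) * real n" "(\<phi> + \<epsilon>) * real n < real r + 1"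
    using assms(3) unfolding r_def by linarith+
  then have "count_less n x q < r" "r \<le> count_le n x q"
    using False assms(3) by linarith+
  then have "r \<in> ranks n x q"
    by (simp add: ranks_def)
  moreover have "(\<phi> - \<epsilon>) * real n \<le> real r"
    using r(2) assms(1) by (simp add: algebra_simps)
  ultimately show ?thesis
    using r(1) unfolding approx_quantile_def by blast
qed

lemma int_set_has_max:
  fixes S :: "int set"
  assumes "q \<in> S" "\<And>z. z \<in> S \<Longrightarrow> z \<le> b"
  shows "\<exists>m \<in> S. \<forall>z \<in> S. z \<le> m"
proof (intro bexI ballI)
  \<comment> \<open>Cutting off below the known element \<open>q\<close> makes the set finite and
    keeps its maximum.\<close>
  let ?T = "S \<inter> {q..b}"
  have "q \<in> ?T"
    using assms by auto
  then have max: "Max ?T \<in> ?T"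
    by (intro Max_in) auto
  then show "Max ?T \<in> S"
    by simp
  fix z
  assume "z \<in> S"
  show "z \<le> Max ?T"
  proof (cases "q \<le> z")
    case True
    then show ?thesis
      using \<open>z \<in> S\<close> assms(2) by (intro Max_ge) auto
  next
    case False
    then show ?thesis
      using max by auto
  qed
qed

lemma int_set_has_min:
  fixes S :: "int set"
  assumes "q \<in> S" "\<And>z. z \<in> S \<Longrightarrow> b \<le> z"
  shows "\<exists>m \<in> S. \<forall>z \<in> S. m \<le> z"
proof -
  have "\<exists>m \<in> uminus ` S. \<forall>z \<in> uminus ` S. z \<le> m"
    by (rule int_set_has_max[of "- q" _ "- b"]) (use assms in auto)
  then show ?thesis
    by auto
qed

section \<open>Correctness of the sampling algorithm\<close>

context sampling
begin

lemma winners_mono: "q \<le> q' \<Longrightarrow> card (winners q h) \<le> card (winners q' h)"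
proof (intro card_mono)
  assume q: "q \<le> q'"
  have "hits q h v \<le> hits q' h v" for v
    using q unfolding hits_def by (induction h) auto
  then show "winners q h \<subseteq> winners q' h"
    unfolding winners_def by (auto intro: order_trans)
qed (simp add: winners_def)

lemma count_le_top: "M \<le> q \<Longrightarrow> count_le n x q = n"
proof -
  assume "M \<le> q"
  then have "{i. i < n \<and> x i \<le> q} = {..<n}"
    using x_range by force
  then show ?thesis
    by (simp add: count_le_def)
qed

lemma count_le_bot: "q < - M \<Longrightarrow> count_le n x q = 0"
proof -
  assume "q < - M"
  then have "{i. i < n \<and> x i \<le> q} = {}"
    using x_range by force
  then show ?thesis
    by (simp add: count_le_def)
qed

text \<open>The two counts can differ only on the union of the forged sets of nine rounds.\<close>

lemma count_le_result:
  assumes h: "h \<in> set_pmf (execution alg n adv x 9)"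
    and few: "\<And>l. l \<in> set h \<Longrightarrow> real (card (forged n l)) \<le> c"
  shows "\<bar>real (count_le n (\<lambda>v. result alg (current_states alg x h v)) q) - real (card (winners q h))\<bar>
    \<le> 9 * c"
proof -
  let ?F = "\<Union>l \<in> set h. forged n l"
  let ?Y = "{v. v < n \<and> result alg (current_states alg x h v) \<le> q}"
  have fin: "finite ?F" "finite (winners q h)"
    by (auto simp: forged_def winners_def)
  have len: "length h = 9"
    using execution_states(1)[OF h n_pos] .
  then have "h \<noteq> []"
    by auto
  \<comment> \<open>Equal logs may collapse in \<open>set h\<close>, so it can have fewer than nine
    elements; \<open>9 * c\<close> is still a bound as \<open>c\<close> is nonnegative.\<close>
  then have "0 \<le> c"
    using few[of "hd h"] by (meson hd_in_set of_nat_0_le_iff order_trans)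
  have "real (card ?F) \<le> (\<Sum>l \<in> set h. real (card (forged n l)))"
    using card_UN_le[of "set h" "forged n"] by (simp flip: of_nat_sum)
  also have "\<dots> \<le> real (card (set h)) * c"
    using few by (intro sum_bounded_above)
  also have "\<dots> \<le> 9 * c"
    using \<open>0 \<le> c\<close> card_length[of h] len by (intro mult_right_mono) auto
  finally have F: "real (card ?F) \<le> 9 * c" .
  have "?Y \<subseteq> winners q h \<union> ?F" "winners q h \<subseteq> ?Y \<union> ?F"
    using unforged_result[OF h] by (auto simp: winners_def simp del: sampling_alg_sel)
  then have "card ?Y \<le> card (winners q h \<union> ?F)" "card (winners q h) \<le> card (?Y \<union> ?F)"
    using fin by (auto intro!: card_mono simp del: sampling_alg_sel)
  then have "card ?Y \<le> card (winners q h) + card ?F" "card (winners q h) \<le> card ?Y + card ?F"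
    using card_Un_le order_trans by blast+
  then show ?thesis
    using F unfolding count_le_def by linarith
qed

end

text \<open>\<open>shift\<close> says that the dummies move the \<phi>-quantile to 1/2, and
  \<open>p_half\<close> that at least half of a rank deviation survives this dilution. By
  \<open>n_large\<close> a rank error of 1 is at most \<epsilon> n / 100.\<close>

locale quantile_shift = sampling +
  fixes \<phi> \<epsilon> \<beta> :: real
  assumes \<phi>_range: "0 < \<phi>" "\<phi> < 1"
    and \<epsilon>_range: "0 < \<epsilon>" "\<epsilon> \<le> 1 / 6"
    and \<beta>_le: "\<beta> \<le> \<epsilon> / 96"
    and adv: "strong_adversary n \<beta> adv"
    and n_large: "100 \<le> \<epsilon> * real n"
    and p_half: "p \<le> 1 / 2"
    and shift: "d = - M \<and> p + (1 - p) * \<phi> = 1 / 2 \<or> d = M \<and> (1 - p) * \<phi> = 1 / 2"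
begin

section \<open>From rank deviations to hit probabilities\<close>

lemma below_top:
  assumes "real (count_le n x q) < (\<phi> - \<epsilon>) * real n"
  shows "q < M"
proof (rule ccontr)
  assume "\<not> q < M"
  with assms have "real n < (\<phi> - \<epsilon>) * real n"
    by (simp add: count_le_top)
  moreover have "(\<phi> - \<epsilon>) * real n \<le> 1 * real n"
    using \<phi>_range \<epsilon>_range by (intro mult_right_mono) auto
  ultimately show False
    by simp
qed

text \<open>The deviation \<epsilon> is scaled by 1 - p \<ge> 1/2, and a dummy at \<open>M\<close>
  is no hit because \<open>q < M\<close>. The constant 99/200 matches
  \<open>hit_prob_ge\<close>.\<close>

lemma hit_prob_le:
  assumes "real (count_le n x q) < (\<phi> - \<epsilon>) * real n"
  shows "hit_prob q \<le> 1 / 2 - 99 / 200 * \<epsilon>"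
proof -
  let ?u = "real (count_le n x q) / real n"
  have "?u \<le> \<phi> - \<epsilon>"
    using assms n_pos by (simp add: field_simps)
  then have "(1 - p) * ?u \<le> (1 - p) * (\<phi> - \<epsilon>)"
    using p_half by (intro mult_left_mono) auto
  moreover have "1 / 2 * \<epsilon> \<le> (1 - p) * \<epsilon>"
    using p_half \<epsilon>_range by (intro mult_right_mono) auto
  ultimately have u: "(1 - p) * ?u \<le> (1 - p) * \<phi> - 1 / 2 * \<epsilon>"
    by (simp add: algebra_simps)
  from shift show ?thesis
  proof
    assume low: "d = - M \<and> p + (1 - p) * \<phi> = 1 / 2"
    have "p * of_bool (d \<le> q) \<le> p"
      using p_range by simp
    then show ?thesis
      using u low \<epsilon>_range unfolding hit_prob_def by linarith
  next
    assume high: "d = M \<and> (1 - p) * \<phi> = 1 / 2"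
    have "\<not> M \<le> q"
      using below_top[OF assms] by simp
    then show ?thesis
      using u high \<epsilon>_range unfolding hit_prob_def by simp
  qed
qed

lemma above_bottom:
  assumes "(\<phi> + \<epsilon>) * real n < real (count_le n x q) + 1"
  shows "- M \<le> q"
proof (rule ccontr)
  assume "\<not> - M \<le> q"
  with assms have "\<phi> * real n + \<epsilon> * real n < 1"
    by (simp add: count_le_bot algebra_simps)
  moreover have "0 \<le> \<phi> * real n"
    using \<phi>_range by simp
  ultimately show False
    using n_large by linarith
qed

text \<open>The \<open>+ 1\<close> costs at most \<epsilon> n / 100, and half of the remaining
  99/100 \<epsilon> survives; a dummy at \<open>- M\<close> is always a hit.\<close>

lemma hit_prob_ge:
  assumes "(\<phi> + \<epsilon>) * real n < real (count_le n x q) + 1"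
  shows "1 / 2 + 99 / 200 * \<epsilon> \<le> hit_prob q"
proof -
  let ?u = "real (count_le n x q) / real n"
  have big: "(\<phi> + 99 / 100 * \<epsilon>) * real n \<le> real (count_le n x q)"
    using assms n_large by (simp add: algebra_simps)
  then have "\<phi> + 99 / 100 * \<epsilon> \<le> ?u"
    using n_pos by (simp add: pos_le_divide_eq)
  then have "(1 - p) * (\<phi> + 99 / 100 * \<epsilon>) \<le> (1 - p) * ?u"
    using p_half by (intro mult_left_mono) auto
  moreover have "1 / 2 * \<epsilon> \<le> (1 - p) * \<epsilon>"
    using p_half \<epsilon>_range by (intro mult_right_mono) auto
  moreover have "(1 - p) * (\<phi> + 99 / 100 * \<epsilon>) = (1 - p) * \<phi> + 99 / 100 * ((1 - p) * \<epsilon>)"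
    by (simp add: algebra_simps)
  ultimately have u: "(1 - p) * \<phi> + 99 / 200 * \<epsilon> \<le> (1 - p) * ?u"
    by linarith
  have "- M \<le> q"
    using above_bottom[OF assms] .
  then show ?thesis
    using shift u p_range unfolding hit_prob_def by auto
qed

text \<open>By monotonicity only the extremal \<open>q\<close> matters, so no union bound over \<open>q\<close> is needed.\<close>

lemma prob_too_many_winners:
  assumes "0 \<le> \<delta>"
  shows "measure_pmf.prob (execution alg n adv x 9)
      {h. \<exists>q. real (count_le n x q) < (\<phi> - \<epsilon>) * real n \<and>
        (1 / 2 - 116 / 100 * \<epsilon> + \<delta>) * real n \<le> real (card (winners q h))}
    \<le> exp (- 2 * real n * \<delta>\<^sup>2)" (is "measure_pmf.prob _ ?E \<le> _")
proof (cases "\<exists>q. real (count_le n x q) < (\<phi> - \<epsilon>) * real n")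
  case True
  then have "\<exists>m \<in> {q. real (count_le n x q) < (\<phi> - \<epsilon>) * real n}.
      \<forall>z \<in> {q. real (count_le n x q) < (\<phi> - \<epsilon>) * real n}. z \<le> m"
    using below_top less_imp_le by (elim exE, intro int_set_has_max[where b = M]) auto
  then obtain m where m: "real (count_le n x m) < (\<phi> - \<epsilon>) * real n"
    and max: "\<And>z. real (count_le n x z) < (\<phi> - \<epsilon>) * real n \<Longrightarrow> z \<le> m"
    by auto
  from m have "hit_prob m \<le> 1 / 2 - 99 / 200 * \<epsilon>"
    by (rule hit_prob_le)
  \<comment> \<open>99/200 \<epsilon> is below 1/12 since \<epsilon> \<le> 1/6. The product 2.36 *
    0.495 = 1.1682 is then rounded down to 1.16.\<close>
  then have "majority_prob (hit_prob m) \<le> 1 / 2 - 236 / 100 * (99 / 200 * \<epsilon>)"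
    using \<epsilon>_range hit_prob_range by (intro majority_prob_le) auto
  then have maj: "majority_prob (hit_prob m) \<le> 1 / 2 - 116 / 100 * \<epsilon>"
    using \<epsilon>_range by simp
  have "?E \<subseteq> {h. (1 / 2 - 116 / 100 * \<epsilon> + \<delta>) * real n \<le> real (card (winners m h))}"
  proof safe
    fix h q
    assume q: "real (count_le n x q) < (\<phi> - \<epsilon>) * real n"
      and "(1 / 2 - 116 / 100 * \<epsilon> + \<delta>) * real n \<le> real (card (winners q h))"
    note this(2)
    also have "real (card (winners q h)) \<le> real (card (winners m h))"
      using winners_mono[OF max[OF q]] by simp
    finally show "(1 / 2 - 116 / 100 * \<epsilon> + \<delta>) * real n \<le> real (card (winners m h))" .
  qed
  then have "measure_pmf.prob (execution alg n adv x 9) ?E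
      \<le> measure_pmf.prob (execution alg n adv x 9)
          {h. (1 / 2 - 116 / 100 * \<epsilon> + \<delta>) * real n \<le> real (card (winners m h))}"
    by (rule measure_pmf.finite_measure_mono) simp
  also have "\<dots> \<le> exp (- 2 * real n * \<delta>\<^sup>2)"
    using maj assms by (rule prob_winners_ge)
  finally show ?thesis .
next
  case False
  then have "?E = {}"
    by blast
  then show ?thesis
    by (simp only: measure_empty exp_ge_zero)
qed

text \<open>Mirror image: the extremal \<open>q\<close> is the smallest one, which exists by
  \<open>above_bottom\<close>.\<close>

lemma prob_too_few_winners:
  assumes "0 \<le> \<delta>"
  shows "measure_pmf.prob (execution alg n adv x 9)
      {h. \<exists>q. (\<phi> + \<epsilon>) * real n < real (count_le n x q) + 1 \<and>
        real (card (winners q h)) \<le> (1 / 2 + 116 / 100 * \<epsilon> - \<delta>) * real n}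
    \<le> exp (- 2 * real n * \<delta>\<^sup>2)" (is "measure_pmf.prob _ ?E \<le> _")
proof (cases "\<exists>q. (\<phi> + \<epsilon>) * real n < real (count_le n x q) + 1")
  case True
  then have "\<exists>m \<in> {q. (\<phi> + \<epsilon>) * real n < real (count_le n x q) + 1}.
      \<forall>z \<in> {q. (\<phi> + \<epsilon>) * real n < real (count_le n x q) + 1}. m \<le> z"
    using above_bottom by (elim exE, intro int_set_has_min[where b = "- M"]) auto
  then obtain m where m: "(\<phi> + \<epsilon>) * real n < real (count_le n x m) + 1"
    and min: "\<And>z. (\<phi> + \<epsilon>) * real n < real (count_le n x z) + 1 \<Longrightarrow> m \<le> z"
    by auto
  from m have "1 / 2 + 99 / 200 * \<epsilon> \<le> hit_prob m"
    by (rule hit_prob_ge)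
  then have "1 / 2 + 236 / 100 * (99 / 200 * \<epsilon>) \<le> majority_prob (hit_prob m)"
    using \<epsilon>_range hit_prob_range by (intro majority_prob_ge) auto
  then have maj: "1 / 2 + 116 / 100 * \<epsilon> \<le> majority_prob (hit_prob m)"
    using \<epsilon>_range by simp
  have "?E \<subseteq> {h. real (card (winners m h)) \<le> (1 / 2 + 116 / 100 * \<epsilon> - \<delta>) * real n}"
  proof safe
    fix h q
    assume q: "(\<phi> + \<epsilon>) * real n < real (count_le n x q) + 1"
      and le: "real (card (winners q h)) \<le> (1 / 2 + 116 / 100 * \<epsilon> - \<delta>) * real n"
    have "real (card (winners m h)) \<le> real (card (winners q h))"
      using winners_mono[OF min[OF q]] by simp
    also note le
    finally show "real (card (winners m h)) \<le> (1 / 2 + 116 / 100 * \<epsilon> - \<delta>) * real n" .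
  qed
  then have "measure_pmf.prob (execution alg n adv x 9) ?E
      \<le> measure_pmf.prob (execution alg n adv x 9)
          {h. real (card (winners m h)) \<le> (1 / 2 + 116 / 100 * \<epsilon> - \<delta>) * real n}"
    by (rule measure_pmf.finite_measure_mono) simp
  also have "\<dots> \<le> exp (- 2 * real n * \<delta>\<^sup>2)"
    using maj assms by (rule prob_winners_le)
  finally show ?thesis .
next
  case False
  then have "?E = {}"
    by blast
  then show ?thesis
    by (simp only: measure_empty exp_ge_zero)
qed

text \<open>Outside the bad events \<open>B1\<close>, \<open>B2\<close>, \<open>B3\<close> the
  reduction holds deterministically. The factor 11 counts nine rounds of forging and two tails for
  the winners.\<close>

lemma prob_reduces_to_median:
  "1 - 11 * exp (- 2 * real n * (\<epsilon> / 200)\<^sup>2)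
    \<le> measure_pmf.prob (final_values alg n adv x 9) {y. reduces_to_median n \<epsilon> \<phi> x y}"
proof -
  let ?\<delta> = "\<epsilon> / 200"
  let ?X = "execution alg n adv x 9"
  let ?y = "\<lambda>h v. result alg (current_states alg x h v)"
  define B1 :: "bool list round_log list set" where
    "B1 = {h. \<exists>l \<in> set h. (\<beta> + ?\<delta>) * real n \<le> real (card (forged n l))}"
  define B2 where
    "B2 = {h. \<exists>q. real (count_le n x q) < (\<phi> - \<epsilon>) * real n \<and>
        (1 / 2 - 116 / 100 * \<epsilon> + ?\<delta>) * real n \<le> real (card (winners q h))}"
  define B3 where
    "B3 = {h. \<exists>q. (\<phi> + \<epsilon>) * real n < real (count_le n x q) + 1 \<and>
        real (card (winners q h)) \<le> (1 / 2 + 116 / 100 * \<epsilon> - ?\<delta>) * real n}"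
  define G where "G = {h. reduces_to_median n \<epsilon> \<phi> x (?y h)}"
  have good: "h \<in> G" if h: "h \<in> set_pmf ?X" and nb: "h \<notin> B1" "h \<notin> B2" "h \<notin> B3" for h
  proof -
    have "real (card (forged n l)) \<le> (\<beta> + ?\<delta>) * real n" if "l \<in> set h" for l
      using nb(1) that unfolding B1_def by force
    from count_le_result[OF h this]
    have close: "\<bar>real (count_le n (?y h) q) - real (card (winners q h))\<bar> \<le> 9 * ((\<beta> + ?\<delta>) * real n)" for q
      by blast
    \<comment> \<open>9/96 + 9/200 = 0.13875. An approximate median allows a deviation of \<epsilon>
      n, and 1 + 0.14 is less than 1.16 - 1/200 = 1.155.\<close>
    have "9 * (\<beta> + ?\<delta>) \<le> 14 / 100 * \<epsilon>"
      using \<beta>_le \<epsilon>_range by simp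
    then have slack: "9 * ((\<beta> + ?\<delta>) * real n) \<le> 14 / 100 * (\<epsilon> * real n)"
      using mult_right_mono[of "9 * (\<beta> + ?\<delta>)" "14 / 100 * \<epsilon>" "real n"] by (simp add: algebra_simps)
    have pos: "0 < \<epsilon> * real n"
      using n_large by linarith
    have "approx_quantile n x \<epsilon> \<phi> q" if "approx_median n (?y h) \<epsilon> q" for q
    proof (rule approx_quantileI)
      note med = approx_quantile_bounds[OF that[unfolded approx_median_def]]
      show "1 \<le> 2 * \<epsilon> * real n"
        using n_large by simp
      show "(\<phi> - \<epsilon>) * real n \<le> real (count_le n x q)"
      proof (rule ccontr)
        assume "\<not> ?thesis"
        then have "real (card (winners q h)) < (1 / 2 - 116 / 100 * \<epsilon> + ?\<delta>) * real n"
          using nb(2) unfolding B2_def mem_Collect_eq not_ex de_Morgan_conj not_le not_less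
          by (metis not_le)
        then have "real (card (winners q h)) < real n / 2 - 1155 / 1000 * (\<epsilon> * real n)"
          by (simp add: algebra_simps)
        moreover have "real n / 2 - \<epsilon> * real n \<le> real (count_le n (?y h) q)"
          using med(1) by (simp add: algebra_simps)
        ultimately show False
          using close[of q] slack pos by linarith
      qed
      show "real (count_less n x q) + 1 \<le> (\<phi> + \<epsilon>) * real n"
      proof (rule ccontr)
        assume "\<not> ?thesis"
        \<comment> \<open>Values are integers, so \<open>count_less\<close> at \<open>q\<close>
          brings in \<open>B3\<close> at \<open>q - 1\<close>.\<close>
        then have "(1 / 2 + 116 / 100 * \<epsilon> - ?\<delta>) * real n < real (card (winners (q - 1) h))"
          using nb(3) unfolding B3_def count_less_eq mem_Collect_eq
          by (metis not_le)
        then have "real n / 2 + 1155 / 1000 * (\<epsilon> * real n) < real (card (winners (q - 1) h))"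
          by (simp add: algebra_simps)
        moreover have "real (count_le n (?y h) (q - 1)) \<le> real n / 2 + \<epsilon> * real n"
          using med(2) by (simp add: algebra_simps count_less_eq)
        ultimately show False
          using close[of "q - 1"] slack pos by linarith
      qed
    qed
    then show ?thesis
      by (simp add: G_def reduces_to_median_def)
  qed
  have "1 = measure_pmf.prob ?X (set_pmf ?X)"
    by (simp add: measure_pmf.prob_eq_1 AE_measure_pmf_iff)
  also have "\<dots> \<le> measure_pmf.prob ?X (G \<union> (B1 \<union> (B2 \<union> B3)))"
    using good by (intro measure_pmf.finite_measure_mono) auto
  also have "\<dots> \<le> measure_pmf.prob ?X G + (measure_pmf.prob ?X B1
      + (measure_pmf.prob ?X B2 + measure_pmf.prob ?X B3))"
    by (intro order_trans[OF measure_Un_le] add_mono order_refl) simp_all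
  also have "measure_pmf.prob ?X B1 \<le> 9 * exp (- 2 * real n * ?\<delta>\<^sup>2)"
    using prob_forged_execution[OF n_pos adv, of ?\<delta> alg x 9] \<epsilon>_range unfolding B1_def by simp
  also have "measure_pmf.prob ?X B2 \<le> exp (- 2 * real n * ?\<delta>\<^sup>2)"
    unfolding B2_def using \<epsilon>_range by (intro prob_too_many_winners) simp
  also have "measure_pmf.prob ?X B3 \<le> exp (- 2 * real n * ?\<delta>\<^sup>2)"
    unfolding B3_def using \<epsilon>_range by (intro prob_too_few_winners) simp
  finally have "1 - 11 * exp (- 2 * real n * ?\<delta>\<^sup>2) \<le> measure_pmf.prob ?X G"
    by simp
  then show ?thesis
    unfolding final_values_def G_def by (simp add: vimage_def)
qed

end

section \<open>Choice of the parameters\<close>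

text \<open>The interval has \<open>2 * n ^ k + 1\<close> \<le> \<open>n ^ (k + 2)\<close> \<le>
  \<open>2 ^ b\<close> elements, so it injects into the words of length \<open>b\<close>.\<close>

lemma exists_short_code:
  assumes "3 \<le> n"
  shows "\<exists>e :: int \<Rightarrow> bool list. inj_on e {- (int n ^ k)..int n ^ k} \<and>
    (\<forall>z. real (length (e z)) \<le> 3 * (real k + 2) * ln (real n))"
proof -
  define j where "j = nat \<lceil>log 2 (real n)\<rceil>"
  define b where "b = (k + 2) * j"
  let ?I = "{- (int n ^ k)..int n ^ k}"
  let ?L = "{l :: bool list. set l \<subseteq> UNIV \<and> length l = b}"
  have "real n \<le> 2 powr real j"
    using assms unfolding j_def by (subst log_le_iff[symmetric]) auto
  then have "n \<le> 2 ^ j"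
    by (simp add: powr_realpow)
  then have "n ^ (k + 2) \<le> (2 ^ j) ^ (k + 2)"
    by (rule power_mono) simp
  moreover have "(2 ^ j) ^ (k + 2) = (2 :: nat) ^ b"
    by (simp only: b_def power_mult[symmetric] mult.commute)
  moreover have "2 * n ^ k + 1 \<le> n ^ (k + 2)"
  proof -
    have "3 * 1 \<le> n * n"
      using assms by (intro mult_le_mono) auto
    then have "3 * n ^ k \<le> n ^ 2 * n ^ k"
      by (intro mult_le_mono1) (simp add: power2_eq_square)
    moreover have "1 \<le> n ^ k"
      using assms by simp
    moreover have "n ^ (k + 2) = n ^ 2 * n ^ k"
      by (simp only: power_add mult.commute)
    ultimately show ?thesis
      by linarith
  qed
  moreover have "card ?I = 2 * n ^ k + 1"
    by (simp add: nat_add_distrib nat_mult_distrib nat_power_eq)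
  moreover have "card ?L = 2 ^ b"
    by (subst card_lists_length_eq) simp_all
  ultimately have "card ?I \<le> card ?L"
    by simp
  moreover have "finite ?L"
    by (rule finite_lists_length_eq) simp
  ultimately obtain f where f: "f ` ?I \<subseteq> ?L" "inj_on f ?I"
    using card_le_inj[of ?I ?L] by auto
  \<comment> \<open>The empty word outside the interval extends the length bound to all integers,
    hence to replies from arbitrary states.\<close>
  let ?e = "\<lambda>z. if z \<in> ?I then f z else []"
  have "inj_on ?e ?I"
    using f(2) by (auto simp: inj_on_def)
  moreover have "real (length (?e z)) \<le> 3 * (real k + 2) * ln (real n)" for z
  proof -
    \<comment> \<open>Rounding up costs 1 \<le> ln n, as n \<ge> 3 > e, and the binary logarithm is
      at most 2 ln n; together 3 ln n.\<close>
    have ln3: "1 \<le> ln (real n)"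
      using assms e_less_272 by (subst ln_ge_iff) auto
    have "real j \<le> log 2 (real n) + 1"
      using assms unfolding j_def by (simp add: of_nat_nat)
    also have "log 2 (real n) \<le> ln (real n) / (1 / 2)"
      unfolding log_def using ln2_ge_two_thirds ln3 by (intro divide_left_mono) auto
    finally have "real j \<le> 3 * ln (real n)"
      using ln3 by simp
    then have "(real k + 2) * real j \<le> (real k + 2) * (3 * ln (real n))"
      by (intro mult_left_mono) auto
    then have "real b \<le> 3 * (real k + 2) * ln (real n)"
      by (simp add: b_def algebra_simps)
    moreover have "length (?e z) \<le> b"
    proof (cases "z \<in> ?I")
      case True
      with f(1) have "f z \<in> ?L"
        by blast
      then show ?thesis
        by simp
    qed auto
    ultimately show ?thesis
      by linarith
  qed
  ultimately show ?thesis
    by blast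
qed

text \<open>Replacing a fraction \<open>p\<close> of the values by the smallest (largest) possible value moves the
  \<open>\<phi>\<close>-quantile for \<open>\<phi> \<le> 1/2\<close> (\<open>\<phi> \<ge> 1/2\<close>) to the median.\<close>

definition dummy_prob :: "real \<Rightarrow> real" where
  "dummy_prob \<phi> = (if \<phi> \<le> 1 / 2 then (1 / 2 - \<phi>) / (1 - \<phi>) else 1 - 1 / (2 * \<phi>))"

lemma dummy_prob_range:
  assumes "0 < \<phi>" "\<phi> < 1"
  shows "dummy_prob \<phi> \<in> {0..1 / 2}"
  using assms by (auto simp: dummy_prob_def field_simps)

lemma dummy_prob_shift:
  assumes "0 < \<phi>" "\<phi> < 1"
  shows "\<phi> \<le> 1 / 2 \<Longrightarrow> dummy_prob \<phi> + (1 - dummy_prob \<phi>) * \<phi> = 1 / 2"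
    and "\<not> \<phi> \<le> 1 / 2 \<Longrightarrow> (1 - dummy_prob \<phi>) * \<phi> = 1 / 2"
proof -
  assume "\<phi> \<le> 1 / 2"
  then have "dummy_prob \<phi> * (1 - \<phi>) = 1 / 2 - \<phi>"
    by (simp add: dummy_prob_def)
  then show "dummy_prob \<phi> + (1 - dummy_prob \<phi>) * \<phi> = 1 / 2"
    by (simp add: algebra_simps)
qed (use assms in \<open>simp add: dummy_prob_def\<close>)

text \<open>The lower bound makes n \<epsilon>^2 at least of order n^(3/5) (ln n)^(2/5), which
  outgrows every multiple of ln n.\<close>

lemma eventually_large:
  fixes \<epsilon> :: "nat \<Rightarrow> real"
  assumes "\<And>n. n \<ge> 1 \<Longrightarrow> 0 < \<epsilon> n"
    and "\<epsilon> \<in> \<Omega>(\<lambda>n. ln (real n) powr (1 / 5) / real n powr (1 / 5))"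
  shows "\<forall>\<^sub>F n in sequentially. 100 \<le> \<epsilon> n * real n \<and>
    11 * exp (- 2 * real n * (\<epsilon> n / 200)\<^sup>2) \<le> real n powr (- 1)"
proof -
  let ?g = "\<lambda>n. ln (real n) powr (1 / 5) / real n powr (1 / 5)"
  obtain c where c: "0 < c" and low: "\<forall>\<^sub>F n in sequentially. c * norm (?g n) \<le> norm (\<epsilon> n)"
    using assms(2) by (auto elim: landau_omega.bigE)
  have "\<forall>\<^sub>F n in sequentially. 100 \<le> c * ?g n * real n"
    using c by real_asymp
  moreover have "\<forall>\<^sub>F n in sequentially. 11 * exp (- 2 * real n * (c * ?g n / 200)\<^sup>2) \<le> real n powr (- 1)"
    using c by real_asymp
  ultimately show ?thesis
    using low eventually_ge_at_top[of 1]
  proof eventually_elim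
    case (elim n)
    \<comment> \<open>Both claims are monotone in \<open>\<epsilon> n\<close>, so its asymptotic
      lower bound \<open>t\<close> suffices.\<close>
    define t where "t = c * ?g n"
    have t: "0 \<le> t" "t \<le> \<epsilon> n"
      using elim(3,4) c assms(1)[of n] by (auto simp: t_def abs_of_nonneg)
    have "t * real n \<le> \<epsilon> n * real n"
      using t by (intro mult_right_mono) auto
    moreover have "(t / 200)\<^sup>2 \<le> (\<epsilon> n / 200)\<^sup>2"
      using t by (intro power_mono divide_right_mono) auto
    then have "exp (- 2 * real n * (\<epsilon> n / 200)\<^sup>2) \<le> exp (- 2 * real n * (t / 200)\<^sup>2)"
      by (simp add: mult_left_mono)
    ultimately show ?case
      using elim(1,2) unfolding t_def[symmetric] by linarith
  qed
qed

theorem theorem2: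
  fixes \<epsilon> \<beta> :: "nat \<Rightarrow> real" and k :: nat
  assumes "\<And>n. n \<ge> 1 \<Longrightarrow> 0 < \<epsilon> n \<and> \<epsilon> n < 1"
    and "\<And>n. n \<ge> 1 \<Longrightarrow> 0 < \<beta> n \<and> \<beta> n < 1"
    and "\<And>n. n \<ge> 1 \<Longrightarrow> \<epsilon> n \<le> 1 / 6"
    and "\<And>n. n \<ge> 1 \<Longrightarrow> \<beta> n \<le> \<epsilon> n powr (5 / 2) / 16"
    and "\<epsilon> \<in> \<Omega>(\<lambda>n. ln (real n) powr (1 / 5) / real n powr (1 / 5))"
  shows "\<exists>(A :: nat \<Rightarrow> real \<Rightarrow> bool list gossip_alg) (T :: nat \<Rightarrow> real \<Rightarrow> nat)
            (K :: real) (C :: real) (\<gamma> :: real) (l :: nat) (N :: nat).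
    \<gamma> > 0 \<and>
    (\<forall>n \<ge> N. \<forall>\<phi>. 0 < \<phi> \<and> \<phi> < 1 \<longrightarrow>
       message_size_le (A n \<phi>) (K * ln (real n)) \<and>
       real (T n \<phi>) \<le> C * ln (1 / \<epsilon> n) \<and>
       (\<forall>s. \<bar>result (A n \<phi>) s\<bar> \<le> int n ^ l) \<and>
       (\<forall>x adv. (\<forall>i < n. \<bar>x i\<bar> \<le> int n ^ k) \<and> strong_adversary n (\<beta> n) adv \<longrightarrow>
          measure_pmf.prob (final_values (A n \<phi>) n adv x (T n \<phi>))
            {y. reduces_to_median n (\<epsilon> n) \<phi> x y} \<ge> 1 - real n powr (- \<gamma>)))"
proof -
  obtain N where N: "\<And>n. N \<le> n \<Longrightarrow> 100 \<le> \<epsilon> n * real n"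
      "\<And>n. N \<le> n \<Longrightarrow> 11 * exp (- 2 * real n * (\<epsilon> n / 200)\<^sup>2) \<le> real n powr (- 1)"
    using eventually_large[of \<epsilon>] assms(1,5) unfolding eventually_sequentially by blast
  obtain e :: "nat \<Rightarrow> int \<Rightarrow> bool list" where
    e: "\<And>n. 3 \<le> n \<Longrightarrow> inj_on (e n) {- (int n ^ k)..int n ^ k}"
       "\<And>n z. 3 \<le> n \<Longrightarrow> real (length (e n z)) \<le> 3 * (real k + 2) * ln (real n)"
    using exists_short_code[of _ k] by metis
  define d where "d n \<phi> = (if \<phi> \<le> 1 / 2 then - (int n ^ k) else int n ^ k)" for n and \<phi> :: real
  define A where "A n \<phi> = sampling_alg (int n ^ k) (e n) (dummy_prob \<phi>) (d n \<phi>)" for n \<phi>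
  have main: "message_size_le (A n \<phi>) (3 * (real k + 2) * ln (real n)) \<and>
       real 9 \<le> 9 * ln (1 / \<epsilon> n) \<and>
       (\<forall>s. \<bar>result (A n \<phi>) s\<bar> \<le> int n ^ k) \<and>
       (\<forall>x adv. (\<forall>i < n. \<bar>x i\<bar> \<le> int n ^ k) \<and> strong_adversary n (\<beta> n) adv \<longrightarrow>
          measure_pmf.prob (final_values (A n \<phi>) n adv x 9)
            {y. reduces_to_median n (\<epsilon> n) \<phi> x y} \<ge> 1 - real n powr (- 1))"
    if n: "max N 3 \<le> n" and \<phi>: "0 < \<phi> \<and> \<phi> < 1" for n \<phi>
  proof (intro conjI allI impI)
    have \<epsilon>: "0 < \<epsilon> n" "\<epsilon> n \<le> 1 / 6"
      using assms(1,3) n by auto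
    show "message_size_le (A n \<phi>) (3 * (real k + 2) * ln (real n))"
      using e(2) n by (simp add: message_size_le_def A_def)
    \<comment> \<open>As 6 > e, the logarithm is at least 1, so nine rounds are
      O(log(1/\<epsilon>)).\<close>
    have "6 \<le> 1 / \<epsilon> n"
      using \<epsilon> by (simp add: field_simps)
    then have "1 \<le> ln (1 / \<epsilon> n)"
      using \<epsilon> e_less_272 by (subst ln_ge_iff) auto
    then show "real 9 \<le> 9 * ln (1 / \<epsilon> n)"
      by simp
    show "\<bar>result (A n \<phi>) s\<bar> \<le> int n ^ k" for s
      by (auto simp: A_def max_def min_def abs_le_iff)
    show "1 - real n powr (- 1) \<le> measure_pmf.prob (final_values (A n \<phi>) n adv x 9)
        {y. reduces_to_median n (\<epsilon> n) \<phi> x y}"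
      if xadv: "(\<forall>i < n. \<bar>x i\<bar> \<le> int n ^ k) \<and> strong_adversary n (\<beta> n) adv" for x adv
    proof -
      \<comment> \<open>\<epsilon>^(5/2) \<le> \<epsilon>^2 \<le> \<epsilon>/6 yields the linear
        bound on \<beta> in \<open>quantile_shift\<close>.\<close>
      have "\<epsilon> n powr (5 / 2) \<le> \<epsilon> n powr 2"
        using \<epsilon> by (intro powr_mono') auto
      also have "\<dots> = \<epsilon> n * \<epsilon> n"
        using \<epsilon> by (simp add: powr_numeral power2_eq_square)
      also have "\<dots> \<le> \<epsilon> n * (1 / 6)"
        using \<epsilon> by (intro mult_left_mono) auto
      finally have "\<beta> n \<le> \<epsilon> n / 96"
        using assms(4)[of n] n by simp
      moreover have "dummy_prob \<phi> \<in> {0..1 / 2}"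
        using dummy_prob_range \<phi> by blast
      moreover have "x i \<in> {- (int n ^ k)..int n ^ k}" if "i < n" for i
        using xadv that by (auto simp: abs_le_iff)
      ultimately interpret quantile_shift n "int n ^ k" "e n" "dummy_prob \<phi>" "d n \<phi>" x adv \<phi> "\<epsilon> n" "\<beta> n"
        using xadv \<epsilon> \<phi> n e(1)[of n] N(1)[of n] dummy_prob_shift[of \<phi>]
        by unfold_locales (auto simp: d_def)
      show ?thesis
        using prob_reduces_to_median N(2)[of n] n unfolding A_def by simp
    qed
  qed
  \<comment> \<open>Nine rounds, \<gamma> = 1 and output exponent \<open>k\<close>; the 3 in
    \<open>max N 3\<close> is for the code.\<close>
  show ?thesis
    by (rule exI[of _ A], rule exI[of _ "\<lambda>_ _. 9"], rule exI[of _ "3 * (real k + 2)"],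
        rule exI[of _ 9], rule exI[of _ 1], rule exI[of _ k], rule exI[of _ "max N 3"])
      (intro conjI[OF zero_less_one] allI impI main)
qed

end
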